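(* Let $\alpha>-1$ be real, $q\in\mathbb{N}=\{0,1,2,\dots\}$, and $n\ge 1$. For nonnegative integers $i,j$ and $m\ge 1$, denote by $x_{m,m}^{\alpha+i,q+j}$ the largest zero of $P_m^{\alpha+i,q+j}$. Then $$x_{2n-2j,\,2n-2j}^{\alpha+j,\,q+j}<x_{2n-2i,\,2n-2i}^{\alpha+i,\,q+i},\qquad 0\le i<j\le n-1.$$
   Context: For real $\alpha>-1$ and $q\in\mathbb{N}=\{0,1,2,\dots\}$, let $w_{\alpha,q}(x)=x^{2q+1}(1-x^2)^{\alpha}(1-x)$ on $[-1,1]$ (a weight that changes sign at $0$). $(P_n^{\alpha,q})_{n\ge0}$ denotes the monic orthogonal polynomial sequence for $w_{\alpha,q}$: each $P_n^{\alpha,q}$ is a monic polynomial of degree exactly $n$, $\int_{-1}^1 w_{\alpha,q}(x)x^kP_n^{\alpha,q}(x)\,dx=0$ for $0\le k\le n-1$, and $\int_{-1}^1 w_{\alpha,q}(x)x^nP_n^{\alpha,q}(x)\,dx\ne 0$. The zeros of these polynomials are real, so "largest zero" means the largest real zero. *)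

theory Defs
  imports "HOL-Analysis.Analysis" "HOL-Computational_Algebra.Polynomial"
begin

(* 0 powr a = 0 for every a, so the weight is 0 at both endpoints (also for \<alpha> \<le> 0);
   this changes it only on a null set. *)
definition weight :: "real \<Rightarrow> nat \<Rightarrow> real \<Rightarrow> real" where
  "weight \<alpha> q x = x ^ (2 * q + 1) * (1 - x\<^sup>2) powr \<alpha> * (1 - x)"

definition monic_ops :: "(real \<Rightarrow> real) \<Rightarrow> (nat \<Rightarrow> real poly) \<Rightarrow> bool" where
  "monic_ops w P \<longleftrightarrow>
     (\<forall>n. degree (P n) = n \<and> lead_coeff (P n) = 1 \<and>
          (\<forall>k<n. (LBINT x:{-1..1}. w x * x ^ k * poly (P n) x) = 0) \<and>
          (LBINT x:{-1..1}. w x * x ^ n * poly (P n) x) \<noteq> 0)"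

(* For \<alpha> > -1 exactly one such sequence exists: the even-degree members are R(x^2) and the
   odd-degree members (x + 1) S(x^2), with R, S monic shifted Jacobi polynomials. *)
definition ortho_poly :: "real \<Rightarrow> nat \<Rightarrow> nat \<Rightarrow> real poly" where
  "ortho_poly \<alpha> q = (THE P. monic_ops (weight \<alpha> q) P)"

definition largest_zero :: "real \<Rightarrow> nat \<Rightarrow> nat \<Rightarrow> real" where
  "largest_zero \<alpha> q m = Max {x. poly (ortho_poly \<alpha> q m) x = 0}"

end

theory Submission imports Defs begin

text \<open>
The weight is \<open>x^(2q+1) (1-x^2)^\<alpha>\<close>, which is odd, minus \<open>x^(2q+2) (1-x^2)^\<alpha>\<close>, which is
even. Integrated against a polynomial in \<open>x^2\<close>, or against \<open>x\<close> times such a polynomial, only one of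
the two parts survives, and in both cases what remains is, up to sign, the functional
\<open>J\<^bsub>\<alpha>,q\<^esub>(p) = \<integral> x^(2q+2) (1-x^2)^\<alpha> p(x^2) dx\<close>. Under \<open>t = x^2\<close> this is integration of \<open>p(t)\<close>
against the positive Jacobi weight \<open>t^(q+1/2) (1-t)^\<alpha>\<close> on \<open>(0,1)\<close>. Consequently the orthogonal
polynomial of degree \<open>2m\<close> is \<open>R(x^2)\<close>, where \<open>R\<close> is the monic orthogonal polynomial of degree \<open>m\<close>
for \<open>J\<^bsub>\<alpha>,q\<^esub>\<close>, and the one of degree \<open>2m+1\<close> is \<open>(x+1) S(x^2)\<close> with \<open>S\<close> of degree \<open>m\<close> for
\<open>J\<^bsub>\<alpha>+1,q\<^esub>\<close> (lemma \<open>ortho_poly_even_degree\<close>).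

Because \<open>J\<close> is positive, \<open>R\<close> is a product of distinct linear factors with roots in \<open>(0,1)\<close>
(\<open>orthogonal_poly_splits\<close>), so the largest zero of \<open>R(x^2)\<close> is the square root of the largest root
of \<open>R\<close>. Integration by parts shows that \<open>R'\<close> is, up to a constant, the orthogonal polynomial of
degree \<open>m-1\<close> for \<open>J\<^bsub>\<alpha>+1,q+1\<^esub>\<close> (\<open>pderiv_orthogonal\<close>). Raising both parameters by one and lowering
the degree by two therefore amounts to differentiating \<open>R\<close>, and the derivative of a polynomial with
only real simple roots is positive from its largest root on (\<open>pderiv_pos_right_of_roots\<close>): all
roots of \<open>R'\<close> lie strictly to the left. Iterating this step gives the theorem.
\<close>

section \<open>Real polynomials with simple roots\<close>

text \<open>
The set \<open>A\<close> consists of the points of \<open>(0,1)\<close> at which \<open>p\<close> changes sign. It is built by removing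
one root at a time: removing a root \<open>r\<close> toggles the membership of \<open>r\<close> in \<open>A\<close>, which keeps track of
the parity of its multiplicity. Once no root is left in \<open>(0,1)\<close>, the intermediate value theorem
makes the sign constant.
\<close>

lemma poly_sign_change_divisor:
  fixes p :: "real poly"
  assumes "p \<noteq> 0"
  shows "\<exists>A \<subseteq> {0<..<1}. finite A \<and> (\<Prod>r\<in>A. [:-r, 1:]) dvd p \<and>
    ((\<forall>x\<in>{0<..<1}. poly (p * (\<Prod>r\<in>A. [:-r, 1:])) x \<ge> 0) \<or>
     (\<forall>x\<in>{0<..<1}. poly (p * (\<Prod>r\<in>A. [:-r, 1:])) x \<le> 0))"
  using assms
proof (induction "degree p" arbitrary: p rule: less_induct)
  case less
  show ?case
  proof (cases "\<exists>r\<in>{0<..<1}. poly p r = 0")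
    case False
    have "\<not> (poly p x < 0 \<and> poly p y > 0)" if "x \<in> {0<..<1}" "y \<in> {0<..<1}" for x y
    proof (cases x y rule: linorder_cases)
      case less
      with poly_IVT_pos[of x y p] that False show ?thesis
        by (meson greaterThanLessThan_iff less_trans)
    next
      case greater
      with poly_IVT_neg[of y x p] that False show ?thesis
        by (meson greaterThanLessThan_iff less_trans)
    qed auto
    then have "(\<forall>x\<in>{0<..<1}. poly p x \<ge> 0) \<or> (\<forall>x\<in>{0<..<1}. poly p x \<le> 0)"
      by (meson not_le)
    then show ?thesis
      by (intro exI[of _ "{}"]) auto
  next
    case True
    then obtain r where r: "r \<in> {0<..<1}" "poly p r = 0" by blast
    then obtain p1 where p1: "p = [:-r, 1:] * p1"
      by (metis dvdE poly_eq_0_iff_dvd)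
    with \<open>p \<noteq> 0\<close> have "p1 \<noteq> 0" by auto
    moreover from this have "degree p1 < degree p"
      unfolding p1 by (subst degree_mult_eq) auto
    ultimately obtain B where B: "B \<subseteq> {0<..<1}" "finite B" "(\<Prod>r\<in>B. [:-r, 1:]) dvd p1"
      and sgn: "(\<forall>x\<in>{0<..<1}. poly (p1 * (\<Prod>r\<in>B. [:-r, 1:])) x \<ge> 0) \<or>
                (\<forall>x\<in>{0<..<1}. poly (p1 * (\<Prod>r\<in>B. [:-r, 1:])) x \<le> 0)"
      using less.hyps by blast
    show ?thesis
    proof (cases "r \<in> B")
      case True
      have split: "(\<Prod>r\<in>B. [:-r, 1:]) = [:-r, 1:] * (\<Prod>r\<in>B - {r}. [:-r, 1:])"
        using B True by (simp add: prod.remove)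
      have "(\<Prod>r\<in>B - {r}. [:-r, 1:]) dvd p"
        using B(3) unfolding split p1 by (meson dvd_mult dvd_mult_right)
      moreover have "p * (\<Prod>r\<in>B - {r}. [:-r, 1:]) = p1 * (\<Prod>r\<in>B. [:-r, 1:])"
        unfolding split p1 by (simp only: mult_ac)
      ultimately show ?thesis
        using B sgn by (intro exI[of _ "B - {r}"]) auto
    next
      case False
      have split: "(\<Prod>r\<in>insert r B. [:-r, 1:]) = [:-r, 1:] * (\<Prod>r\<in>B. [:-r, 1:])"
        using B False by simp
      have "(\<Prod>r\<in>insert r B. [:-r, 1:]) dvd p"
        unfolding split p1 using B(3) by (rule mult_dvd_mono[OF dvd_refl])
      moreover have "poly (p * (\<Prod>r\<in>insert r B. [:-r, 1:])) x =
          (x - r)\<^sup>2 * poly (p1 * (\<Prod>r\<in>B. [:-r, 1:])) x" for x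
        unfolding split p1 by (simp add: power2_eq_square algebra_simps)
      ultimately show ?thesis
        using B r(1) sgn
        by (intro exI[of _ "insert r B"])
           (auto simp: mult_nonneg_nonneg mult_nonneg_nonpos simp del: prod.insert)
    qed
  qed
qed

lemma degree_prod_linear:
  fixes A :: "real set"
  shows "finite A \<Longrightarrow> degree (\<Prod>r\<in>A. [:-r, 1:]) = card A"
  by (subst degree_prod_sum_eq) auto

lemma lead_coeff_prod_linear:
  fixes A :: "real set"
  shows "lead_coeff (\<Prod>r\<in>A. [:-r, 1:]) = 1"
  by (simp add: lead_coeff_prod)

lemma degree_diff_monic_less:
  fixes p q :: "real poly"
  assumes "degree p = n" "lead_coeff p = 1" "degree q = n" "lead_coeff q = 1" "p \<noteq> q"
  shows "degree (p - q) < n"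
proof -
  have "coeff (p - q) n = 0" "degree (p - q) \<le> n"
    using assms degree_diff_le[of p n q] by auto
  then show ?thesis
    using assms(5) by (metis eq_iff_diff_eq_0 le_neq_implies_less leading_coeff_0_iff)
qed

lemma monic_dvd_eq:
  fixes p q :: "real poly"
  assumes "p dvd q" "degree p = degree q" "lead_coeff p = 1" "lead_coeff q = 1"
  shows "p = q"
proof -
  obtain c where c: "q = p * c" using assms(1) by (elim dvdE)
  from assms c have "q \<noteq> 0" by auto
  then have "degree c = 0" using assms(2) c
    by (metis add_cancel_right_right degree_mult_eq mult_zero_left mult_zero_right)
  then obtain a where a: "c = [:a:]" by (metis degree_eq_zeroE)
  have "lead_coeff q = a * lead_coeff p" unfolding c a by (simp add: lead_coeff_mult)
  with assms have "a = 1" by simp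
  with c a show ?thesis by simp
qed

text \<open>
By the product rule the derivative is \<open>\<Sum>a\<in>A. \<Prod>r\<in>A-{a}. x - r\<close>. To the right of all roots every
summand is nonnegative. At \<open>x = Max A\<close> all of them vanish except the one with \<open>a = Max A\<close>, which is
the one that yields strictness.
\<close>

lemma pderiv_pos_right_of_roots:
  fixes A :: "real set"
  assumes "finite A" "A \<noteq> {}" "x \<ge> Max A"
  shows "poly (pderiv (\<Prod>r\<in>A. [:-r, 1:])) x > 0"
proof -
  have gt: "x - r > 0" if "r \<in> A - {Max A}" for r
    using assms that Max_ge[of A r] by (metis Diff_iff diff_gt_0_iff_gt insertCI
        order_le_imp_less_or_eq order_less_le_trans)
  have ge: "x - r \<ge> 0" if "r \<in> A" for r
    using assms that Max_ge[of A r] by linarith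
  have "0 < (\<Sum>a\<in>A. \<Prod>r\<in>A - {a}. x - r)"
  proof (rule sum_pos2)
    show "Max A \<in> A" using assms by simp
    show "0 < (\<Prod>r\<in>A - {Max A}. x - r)" using gt by (intro prod_pos) auto
    show "0 \<le> (\<Prod>r\<in>A - {a}. x - r)" for a using ge by (intro prod_nonneg) auto
  qed fact
  also have "\<dots> = poly (pderiv (\<Prod>r\<in>A. [:-r, 1:])) x"
    by (simp add: pderiv_prod poly_sum poly_prod pderiv_pCons)
  finally show ?thesis .
qed

section \<open>Orthogonality with respect to a linear functional\<close>

locale poly_functional =
  fixes L :: "real poly \<Rightarrow> real"
  assumes add: "L (p + q) = L p + L q"
    and smult: "L (smult c p) = c * L p"
begin

lemma zero: "L 0 = 0"
  using smult[of 0 0] by simp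

lemma diff: "L (p - q) = L p - L q"
  using add[of "p - q" q] by simp

lemma sum: "L (sum f S) = (\<Sum>i\<in>S. L (f i))"
  by (induction S rule: infinite_finite_induct) (auto simp: zero add)

lemma expand_left:
  assumes "degree p \<le> n"
  shows "L (p * f) = (\<Sum>k\<le>n. coeff p k * L (monom 1 k * f))"
proof -
  have "p * f = (\<Sum>k\<le>n. smult (coeff p k) (monom 1 k * f))"
    by (subst poly_as_sum_of_monoms'[OF assms, symmetric])
       (simp add: sum_distrib_right smult_monom flip: mult_smult_left)
  then show ?thesis by (simp add: sum smult)
qed

lemma mult_eq_0_of_monoms:
  assumes "\<And>k. k < n \<Longrightarrow> L (monom 1 k * f) = 0" "degree p < n"
  shows "L (p * f) = 0"
  using assms by (subst expand_left[OF order_refl]) (auto intro!: sum.neutral)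

definition monic_orthogonal_seq :: "(nat \<Rightarrow> real poly) \<Rightarrow> bool" where
  "monic_orthogonal_seq P \<longleftrightarrow>
     (\<forall>n. degree (P n) = n \<and> lead_coeff (P n) = 1 \<and>
       (\<forall>k<n. L (monom 1 k * P n) = 0) \<and> L (monom 1 n * P n) \<noteq> 0)"

text \<open>
No positivity is available for a weight that changes sign, so the difference \<open>D\<close> of two candidates
cannot be tested against itself. It is tested against the member \<open>P d\<close> of the same degree \<open>d\<close>
instead: expanding \<open>P d\<close> gives zero because \<open>D\<close> is orthogonal to all low powers, while expanding
\<open>D\<close> leaves only its leading coefficient times a nonzero norm.
\<close>

lemma monic_orthogonal_seq_unique:
  assumes P: "monic_orthogonal_seq P" and Q: "monic_orthogonal_seq Q"
  shows "P = Q"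
proof (rule ext, rule ccontr)
  fix n
  assume neq: "P n \<noteq> Q n"
  have deg: "degree (P k) = k" "degree (Q k) = k"
    and lead: "lead_coeff (P k) = 1" "lead_coeff (Q k) = 1" for k
    using P Q unfolding monic_orthogonal_seq_def by blast+
  have orth: "L (monom 1 k * P m) = 0" "L (monom 1 k * Q m) = 0" if "k < m" for k m
    using P Q that unfolding monic_orthogonal_seq_def by simp_all
  define D where "D = P n - Q n"
  define d where "d = degree D"
  have "d < n"
    unfolding D_def d_def using deg(1) lead(1) deg(2) lead(2) neq by (rule degree_diff_monic_less)
  have D: "L (monom 1 k * D) = 0" if "k < n" for k
    using orth[OF that] by (simp add: D_def right_diff_distrib diff)
  have "L (P d * D) = 0"
    by (rule mult_eq_0_of_monoms[of n]) (simp_all add: D deg \<open>d < n\<close>)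
  moreover have "L (D * P d) = (\<Sum>k\<le>d. coeff D k * L (monom 1 k * P d))"
    by (rule expand_left) (simp add: d_def)
  moreover have "\<dots> = coeff D d * L (monom 1 d * P d)"
    by (subst sum.remove[of _ d]) (simp_all add: orth)
  ultimately have "coeff D d * L (monom 1 d * P d) = 0"
    by (simp add: mult.commute)
  moreover have "coeff D d \<noteq> 0"
    using neq unfolding d_def leading_coeff_0_iff D_def by simp
  moreover have "L (monom 1 d * P d) \<noteq> 0"
    using P unfolding monic_orthogonal_seq_def by blast
  ultimately show False by simp
qed

end

text \<open>
Positivity covers every polynomial that is nonnegative on the open interval \<open>(0,1)\<close>, whatever its
sign elsewhere, and this is what confines the roots of the orthogonal polynomials to that interval.
\<close>

locale positive_functional = poly_functional +
  assumes pos: "p \<noteq> 0 \<Longrightarrow> (\<And>x. x \<in> {0<..<1} \<Longrightarrow> poly p x \<ge> 0) \<Longrightarrow> L p > 0"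
begin

definition orthogonal_poly :: "nat \<Rightarrow> real poly \<Rightarrow> bool" where
  "orthogonal_poly m R \<longleftrightarrow> degree R = m \<and> lead_coeff R = 1 \<and>
     (\<forall>p. degree p < m \<longrightarrow> L (p * R) = 0)"

lemma square_pos: "p \<noteq> 0 \<Longrightarrow> L (p * p) > 0"
  by (rule pos) auto

text \<open>
Gram-Schmidt in the form of an orthogonal projection onto the polynomials of degree below \<open>m\<close>.
Vanishing coefficients from \<open>m\<close> on describe this space also for \<open>m = 0\<close>, where it is trivial. In the
step, the residue \<open>e\<close> of the monomial of degree \<open>m\<close> extends an orthogonal decomposition of the
smaller space, and the projection of \<open>f\<close> gains the component of \<open>f\<close> along \<open>e\<close>.
\<close>

lemma orthogonal_projection_exists:
  "\<exists>g. (\<forall>k\<ge>m. coeff g k = 0) \<and> (\<forall>p. (\<forall>k\<ge>m. coeff p k = 0) \<longrightarrow> L (p * (f - g)) = 0)"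
proof (induction m arbitrary: f)
  case 0
  have "L (p * f) = 0" if "\<forall>k\<ge>0. coeff p k = 0" for p :: "real poly"
  proof -
    from that have "p = 0" by (simp add: poly_eq_iff)
    then show ?thesis by (simp add: zero)
  qed
  then show ?case by (intro exI[of _ 0]) simp
next
  case (Suc m)
  obtain h where h: "\<forall>k\<ge>m. coeff h k = 0"
      "\<And>p. \<forall>k\<ge>m. coeff p k = 0 \<Longrightarrow> L (p * (monom 1 m - h)) = 0"
    using Suc by blast
  define e where "e = monom 1 m - h"
  have e: "coeff e m = 1" "\<And>k. k > m \<Longrightarrow> coeff e k = 0"
    using h(1) by (auto simp: e_def)
  have ee: "L (e * e) > 0" using e(1) by (intro square_pos) auto
  obtain g where g: "\<forall>k\<ge>m. coeff g k = 0"
      "\<And>p. \<forall>k\<ge>m. coeff p k = 0 \<Longrightarrow> L (p * (f - g)) = 0"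
    using Suc by blast
  define c where "c = L (f * e) / L (e * e)"
  define g' where "g' = g + smult c e"
  have "L (p * (f - g')) = 0" if p: "\<forall>k\<ge>Suc m. coeff p k = 0" for p
  proof -
    define b where "b = coeff p m"
    define p' where "p' = p - smult b e"
    have p': "\<forall>k\<ge>m. coeff p' k = 0"
    proof (intro allI impI)
      fix k assume "k \<ge> m"
      then consider "k = m" | "k \<ge> Suc m" by linarith
      then show "coeff p' k = 0"
        using p e by cases (auto simp: p'_def b_def)
    qed
    have "L (p' * (f - g')) = L (p' * (f - g)) - c * L (p' * e)"
      by (simp add: g'_def algebra_simps diff smult add)
    also have "\<dots> = 0" using g(2)[OF p'] h(2)[OF p'] by (simp add: e_def)
    finally have 1: "L (p' * (f - g')) = 0" .
    have "L (e * (f - g')) = L (f * e) - L (g * e) - c * L (e * e)"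
      by (simp add: g'_def algebra_simps diff smult add)
    also have "\<dots> = 0" using h(2)[OF g(1)] ee by (simp add: e_def[symmetric] c_def)
    finally have 2: "L (e * (f - g')) = 0" .
    have "p = p' + smult b e" by (simp add: p'_def)
    then show ?thesis using 1 2 by (simp add: distrib_right add smult)
  qed
  moreover have "\<forall>k\<ge>Suc m. coeff g' k = 0" using g e by (auto simp: g'_def)
  ultimately show ?case by blast
qed

lemma orthogonal_poly_exists: "\<exists>R. orthogonal_poly m R"
proof -
  obtain g where g: "\<forall>k\<ge>m. coeff g k = 0"
      "\<And>p. \<forall>k\<ge>m. coeff p k = 0 \<Longrightarrow> L (p * (monom 1 m - g)) = 0"
    using orthogonal_projection_exists by blast
  have c: "coeff (monom 1 m - g) m = 1" "\<And>k. k > m \<Longrightarrow> coeff (monom 1 m - g) k = 0"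
    using g(1) by auto
  then have "degree (monom 1 m - g) = m"
    by (metis degree_le le_antisym le_degree zero_neq_one)
  with c g(2) have "orthogonal_poly m (monom 1 m - g)"
    by (auto simp: orthogonal_poly_def coeff_eq_0)
  then show ?thesis ..
qed

lemma orthogonal_poly_unique:
  assumes "orthogonal_poly m R" "orthogonal_poly m S"
  shows "R = S"
proof (rule ccontr)
  assume neq: "R \<noteq> S"
  have "degree (R - S) < m"
    using assms neq by (intro degree_diff_monic_less) (auto simp: orthogonal_poly_def)
  \<comment> \<open>The difference has degree below \<open>m\<close>, hence is orthogonal to both polynomials and so to itself.\<close>
  then have "L ((R - S) * R - (R - S) * S) = 0"
    using assms by (simp only: diff orthogonal_poly_def)
  then show False using square_pos[of "R - S"] neq by (simp add: right_diff_distrib)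
qed

lemma orthogonal_poly_norm_pos:
  assumes "orthogonal_poly m R"
  shows "L (monom 1 m * R) > 0"
proof -
  have R: "degree R = m" "lead_coeff R = 1" "\<And>k. k < m \<Longrightarrow> L (monom 1 k * R) = 0"
    using assms by (auto simp: orthogonal_poly_def degree_monom_eq)
  have "L (R * R) = (\<Sum>k\<le>m. coeff R k * L (monom 1 k * R))"
    using R by (intro expand_left) simp
  also have "\<dots> = L (monom 1 m * R)"
    using R by (subst sum.remove[of _ m]) auto
  finally show ?thesis using square_pos[of R] R by force
qed

text \<open>
The classical sign argument: if \<open>R\<close> changed sign at fewer than \<open>m\<close> points of \<open>(0,1)\<close>, then
multiplying it by the corresponding linear factors would give a nonzero polynomial of constant sign
on which the functional vanishes by orthogonality. So these factors already have the degree of \<open>R\<close>.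
\<close>

lemma orthogonal_poly_splits:
  assumes R: "orthogonal_poly m R"
  shows "\<exists>A \<subseteq> {0<..<1}. finite A \<and> card A = m \<and> R = (\<Prod>r\<in>A. [:-r, 1:])"
proof -
  have R': "degree R = m" "lead_coeff R = 1" "\<And>p. degree p < m \<Longrightarrow> L (p * R) = 0"
    using R by (auto simp: orthogonal_poly_def)
  then have "R \<noteq> 0" by auto
  obtain A where A: "A \<subseteq> {0<..<1}" "finite A" "(\<Prod>r\<in>A. [:-r, 1:]) dvd R"
    and sgn: "(\<forall>x\<in>{0<..<1}. poly (R * (\<Prod>r\<in>A. [:-r, 1:])) x \<ge> 0) \<or>
              (\<forall>x\<in>{0<..<1}. poly (R * (\<Prod>r\<in>A. [:-r, 1:])) x \<le> 0)"
    using poly_sign_change_divisor[OF \<open>R \<noteq> 0\<close>] by blast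
  define T where "T = (\<Prod>r\<in>A. [:-r, 1:])"
  have T: "degree T = card A" "lead_coeff T = 1"
    using A(2) unfolding T_def by (rule degree_prod_linear, intro lead_coeff_prod_linear)
  have RT: "R * T \<noteq> 0" using \<open>R \<noteq> 0\<close> T by auto
  have "L (R * T) \<noteq> 0"
    using sgn
  proof
    assume "\<forall>x\<in>{0<..<1}. poly (R * (\<Prod>r\<in>A. [:-r, 1:])) x \<ge> 0"
    then show ?thesis using RT pos[of "R * T"] by (auto simp: T_def)
  next
    assume "\<forall>x\<in>{0<..<1}. poly (R * (\<Prod>r\<in>A. [:-r, 1:])) x \<le> 0"
    then show ?thesis using RT pos[of "- (R * T)"] diff[of 0 "R * T"] by (auto simp: T_def zero)
  qed
  then have "\<not> card A < m" using R'(3)[of T] T by (auto simp: mult.commute)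
  moreover have "card A \<le> m"
    using dvd_imp_degree_le[of T R] A(3) T R' \<open>R \<noteq> 0\<close> by (simp add: T_def)
  ultimately have "card A = m" by simp
  moreover have "T = R" using A(3) T R' \<open>card A = m\<close> by (intro monic_dvd_eq) (auto simp: T_def)
  ultimately show ?thesis using A T_def by blast
qed

end

section \<open>Integrals against the Jacobi weight\<close>

lemma has_real_derivative_one_minus_square_powr:
  fixes x \<alpha> :: real
  assumes "x\<^sup>2 < 1"
  shows "((\<lambda>x. (1 - x\<^sup>2) powr (\<alpha> + 1)) has_real_derivative
    (\<alpha> + 1) * (1 - x\<^sup>2) powr \<alpha> * (- 2 * x)) (at x)"
proof -
  have "((\<lambda>x. 1 - x\<^sup>2) has_real_derivative - 2 * x) (at x)"
    by (auto intro!: derivative_eq_intros)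
  from DERIV_chain2[OF has_real_derivative_powr this, of "\<alpha> + 1"] assms show ?thesis
    by simp
qed

text \<open>
For negative \<open>\<alpha>\<close> the integrand is unbounded at the endpoints. The factor \<open>x\<close>, which every
integrand below contains, provides an elementary primitive, a multiple of \<open>(1-x^2)^(\<alpha>+1)\<close> that is
continuous up to the endpoints; on \<open>[0,1]\<close> the integrand has constant sign, which makes integrability
absolute, and the other half follows by reflection.
\<close>

lemma abs_integrable_x_times_powr:
  fixes \<alpha> :: real
  assumes "\<alpha> > -1"
  shows "(\<lambda>x::real. x * (1 - x\<^sup>2) powr \<alpha>) absolutely_integrable_on {-1..1}"
proof -
  define f where "f = (\<lambda>x::real. x * (1 - x\<^sup>2) powr \<alpha>)"
  define F where "F = (\<lambda>x::real. - ((1 - x\<^sup>2) powr (\<alpha> + 1)) / (2 * (\<alpha> + 1)))"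
  have "(f has_integral (F 1 - F 0)) {0..1}"
  proof (rule fundamental_theorem_of_calculus_interior)
    show "continuous_on {0..1} F" unfolding F_def
      using assms by (intro continuous_on_powr' continuous_intros) (auto simp: power_le_one)
    fix x :: real assume "x \<in> {0<..<1}"
    then have "x\<^sup>2 < 1" by (simp add: power_less_one_iff)
    note DERIV_cdivide[OF DERIV_minus[OF has_real_derivative_one_minus_square_powr[OF this, of \<alpha>]],
        of "2 * (\<alpha> + 1)"]
    moreover have "- ((\<alpha> + 1) * (1 - x\<^sup>2) powr \<alpha> * (- 2 * x)) / (2 * (\<alpha> + 1)) = f x"
      using assms by (auto simp: f_def field_simps)
    ultimately show "(F has_vector_derivative f x) (at x)"
      unfolding F_def has_real_derivative_iff_has_vector_derivative[symmetric] by (rule DERIV_cong)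
  qed simp
  then have right: "f absolutely_integrable_on {0..1}"
    by (intro nonnegative_absolutely_integrable_1) (auto simp: f_def)
  then have "(\<lambda>x. f (-x)) absolutely_integrable_on {-1..-0}"
    by (subst absolutely_integrable_reflect_real) simp
  then have "(\<lambda>x. - 1 * f (-x)) absolutely_integrable_on {-1..-0}"
    by (rule set_integrable_mult_right)
  then have "f absolutely_integrable_on {-1..0}"
    by (simp add: f_def)
  from absolutely_integrable_Un[OF this right] show ?thesis
    by (simp add: f_def ivl_disj_un_two_touch(4))
qed

lemma integrable_x_times_powr_times:
  fixes \<alpha> :: real and g :: "real \<Rightarrow> real"
  assumes "\<alpha> > -1" and g: "continuous_on UNIV g"
  shows "set_integrable lborel {-1..1} (\<lambda>x. x * (1 - x\<^sup>2) powr \<alpha> * g x)"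
proof -
  have [measurable]: "g \<in> borel_measurable borel"
    using g by (rule borel_measurable_continuous_onI)
  have base: "set_integrable lborel {-1..1} (\<lambda>x::real. x * (1 - x\<^sup>2) powr \<alpha>)"
    using abs_integrable_x_times_powr[OF assms(1)] unfolding set_integrable_def
    by (subst (asm) integrable_completion) auto
  have "bounded (g ` {-1..1})"
    by (intro compact_imp_bounded compact_continuous_image continuous_on_subset[OF g]) auto
  then obtain C where "\<forall>y\<in>g ` {-1..1}. norm y \<le> C"
    unfolding bounded_iff by blast
  then have C: "\<bar>g x\<bar> \<le> C" if "x \<in> {-1..1}" for x
    using that by fastforce
  have "set_integrable lborel {-1..1} (\<lambda>x. C * (x * (1 - x\<^sup>2) powr \<alpha>))"
    using base by (rule set_integrable_mult_right)
  then show ?thesis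
    unfolding set_integrable_def
  proof (rule Bochner_Integration.integrable_bound)
    show "(\<lambda>x. indicat_real {-1..1} x *\<^sub>R (x * (1 - x\<^sup>2) powr \<alpha> * g x)) \<in> borel_measurable lborel"
      by measurable
    show "AE x in lborel. norm (indicat_real {-1..1} x *\<^sub>R (x * (1 - x\<^sup>2) powr \<alpha> * g x))
        \<le> norm (indicat_real {-1..1} x *\<^sub>R (C * (x * (1 - x\<^sup>2) powr \<alpha>)))"
    proof (intro AE_I2)
      fix x :: real
      have "\<bar>x * (1 - x\<^sup>2) powr \<alpha>\<bar> * \<bar>g x\<bar> \<le> \<bar>x * (1 - x\<^sup>2) powr \<alpha>\<bar> * \<bar>C\<bar>" if "x \<in> {-1..1}"
        using C[OF that] by (intro mult_left_mono) auto
      then show "norm (indicat_real {-1..1} x *\<^sub>R (x * (1 - x\<^sup>2) powr \<alpha> * g x))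
        \<le> norm (indicat_real {-1..1} x *\<^sub>R (C * (x * (1 - x\<^sup>2) powr \<alpha>)))"
        by (auto simp: indicator_def abs_mult mult_ac)
    qed
  qed
qed

lemma odd_set_integral_eq_0:
  fixes f :: "real \<Rightarrow> real"
  assumes "\<And>x. f (-x) = - f x"
  shows "(LBINT x:{-a..a}. f x) = 0"
proof -
  have "(LBINT x:{-a..a}. f x) = (LBINT x:{x. -x \<in> {-a..a}}. f (-x))"
    by (rule set_integral_reflect)
  also have "{x. -x \<in> {-a..a}} = {-a..a}" by auto
  also have "(LBINT x:{-a..a}. f (-x)) = - (LBINT x:{-a..a}. f x)"
    unfolding assms set_lebesgue_integral_def by simp
  finally show ?thesis by simp
qed

text \<open>
This is \<open>\<integral> t^(q+1/2) (1-t)^\<alpha> p(t) dt\<close> over \<open>(0,1)\<close> after the substitution \<open>t = x^2\<close>. Staying in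
the variable \<open>x\<close> avoids a change of variables in every comparison with the original weight.
\<close>

definition jacobi_functional :: "real \<Rightarrow> nat \<Rightarrow> real poly \<Rightarrow> real" where
  "jacobi_functional \<alpha> q p =
     (LBINT x:{-1..1}. x ^ (2 * q + 2) * (1 - x\<^sup>2) powr \<alpha> * poly p (x\<^sup>2))"

definition weight_functional :: "real \<Rightarrow> nat \<Rightarrow> real poly \<Rightarrow> real" where
  "weight_functional \<alpha> q p = (LBINT x:{-1..1}. weight \<alpha> q x * poly p x)"

lemma jacobi_integrable:
  assumes "\<alpha> > -1"
  shows "set_integrable lborel {-1..1}
    (\<lambda>x::real. x ^ (2 * q + 2) * (1 - x\<^sup>2) powr \<alpha> * poly p (x\<^sup>2))"
proof -
  have "continuous_on UNIV (\<lambda>x. x ^ (2 * q + 1) * poly p (x\<^sup>2))"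
    by (intro continuous_intros)
  from integrable_x_times_powr_times[OF assms this] show ?thesis
    by (rule set_integrable_cong[THEN iffD1, rotated -1]) (auto simp: mult_ac)
qed

lemma weight_poly_integrable:
  assumes "\<alpha> > -1"
  shows "set_integrable lborel {-1..1} (\<lambda>x. weight \<alpha> q x * poly p x)"
proof -
  have "continuous_on UNIV (\<lambda>x. x ^ (2 * q) * (1 - x) * poly p x)"
    by (intro continuous_intros)
  from integrable_x_times_powr_times[OF assms this] show ?thesis
    by (rule set_integrable_cong[THEN iffD1, rotated -1]) (auto simp: weight_def mult_ac)
qed

text \<open>
The integrand is nonnegative. If its integral were zero, it would vanish almost everywhere, whereas
on \<open>(0,1)\<close> it can vanish only at the finitely many zeros of \<open>p(x^2)\<close>.
\<close>

lemma jacobi_functional_pos: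
  assumes \<alpha>: "\<alpha> > -1" and "p \<noteq> 0" and nonneg: "\<And>x. x \<in> {0<..<1} \<Longrightarrow> poly p x \<ge> 0"
  shows "jacobi_functional \<alpha> q p > 0"
proof -
  define f where "f = (\<lambda>x::real. x ^ (2 * q + 2) * (1 - x\<^sup>2) powr \<alpha> * poly p (x\<^sup>2))"
  define h where "h = (\<lambda>x. indicat_real {-1..1} x * f x)"
  have int: "integrable lborel h"
    using jacobi_integrable[OF \<alpha>, of q p] by (simp add: set_integrable_def h_def f_def)
  have h0: "h x \<ge> 0" for x
  proof (cases "x \<in> {-1<..<1} \<and> x \<noteq> 0")
    case True
    then have "x\<^sup>2 \<in> {0<..<1}" by (simp add: abs_square_less_1 abs_less_iff)
    then have "poly p (x\<^sup>2) \<ge> 0" by (rule nonneg)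
    moreover have "x ^ (2 * q + 2) = (x ^ (q + 1))\<^sup>2"
      by (simp add: power2_eq_square power_add[symmetric] mult_2)
    ultimately show ?thesis by (simp add: h_def f_def)
  next
    case False
    then have "x = 0 \<or> x\<^sup>2 = 1 \<or> x \<notin> {-1..1}" by (auto simp: power2_eq_1_iff)
    then show ?thesis by (auto simp: h_def f_def)
  qed
  have eq: "jacobi_functional \<alpha> q p = (\<integral>x. h x \<partial>lborel)"
    by (simp add: jacobi_functional_def set_lebesgue_integral_def h_def f_def)
  have "(\<integral>x. h x \<partial>lborel) \<noteq> 0"
  proof
    assume "(\<integral>x. h x \<partial>lborel) = 0"
    then have "AE x in lborel. h x = 0"
      using int h0 by (subst (asm) integral_nonneg_eq_0_iff_AE) auto
    moreover have "pcompose p (monom 1 2) \<noteq> 0"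
      using \<open>p \<noteq> 0\<close> by (subst pcompose_eq_0_iff) (auto simp: degree_monom_eq)
    then have "finite {x. poly (pcompose p (monom 1 2)) x = 0}" by (rule poly_roots_finite)
    then have "AE x in lborel. x \<notin> {x. poly (pcompose p (monom 1 2)) x = 0}"
      by (intro AE_not_in) (auto simp: finite_imp_null_set_lborel)
    ultimately have "AE x in lborel. x \<notin> {0<..<1::real}"
    proof eventually_elim
      case (elim x)
      show ?case
      proof
        assume x: "x \<in> {0<..<1}"
        then have "x\<^sup>2 < 1" by (simp add: power_less_one_iff)
        with x elim show False by (auto simp: h_def f_def poly_pcompose poly_monom)
      qed
    qed
    then have "{0<..<1::real} \<in> null_sets lborel" by (subst AE_iff_null_sets) auto
    then show False by (simp add: null_sets_def)
  qed
  moreover have "(\<integral>x. h x \<partial>lborel) \<ge> 0" using h0 by (intro integral_nonneg_AE AE_I2)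
  ultimately show ?thesis by (simp add: eq)
qed

text \<open>
The integrand is the derivative of \<open>x^(2q+3) (1-x^2)^(\<alpha>+1) p(x^2)\<close>, which vanishes at both
endpoints. In the variable \<open>t = x^2\<close> this is Pearson's equation
\<open>(\<sigma> w)' = \<tau> w\<close> for the Jacobi weight \<open>w\<close>, with \<open>\<sigma> = 2 t (1-t)\<close>, integrated against \<open>p\<close>.
\<close>

lemma jacobi_pearson:
  assumes \<alpha>: "\<alpha> > -1"
  shows "jacobi_functional \<alpha> q ([:of_nat (2 * q + 3), - (of_nat (2 * q + 3) + 2 * (\<alpha> + 1)):] * p
           + [:0, 2, -2:] * pderiv p) = 0"
proof -
  define f where "f = [:of_nat (2 * q + 3), - (of_nat (2 * q + 3) + 2 * (\<alpha> + 1)):] * p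
           + [:0, 2, -2:] * pderiv p"
  define F where "F = (\<lambda>x::real. x ^ (2 * q + 3) * (1 - x\<^sup>2) powr (\<alpha> + 1) * poly p (x\<^sup>2))"
  have "((\<lambda>x. x ^ (2 * q + 2) * (1 - x\<^sup>2) powr \<alpha> * poly f (x\<^sup>2)) has_integral (F 1 - F (-1))) {-1..1}"
  proof (rule fundamental_theorem_of_calculus_interior)
    show "continuous_on {-1..1} F" unfolding F_def
      using \<alpha> by (intro continuous_on_powr' continuous_intros) (auto simp: abs_square_le_1)
    fix x :: real assume "x \<in> {-1<..<1}"
    then have x: "x\<^sup>2 < 1" by (simp add: abs_square_less_1 abs_less_iff)
    have p: "((\<lambda>x. poly p (x\<^sup>2)) has_real_derivative poly (pderiv p) (x\<^sup>2) * (2 * x)) (at x)"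
      by (rule DERIV_chain'[of "\<lambda>x. x\<^sup>2" _ x UNIV "poly p", simplified])
         (auto intro!: derivative_eq_intros poly_DERIV)
    have w: "((\<lambda>x. (1 - x\<^sup>2) powr (\<alpha> + 1)) has_real_derivative
        (\<alpha> + 1) * (1 - x\<^sup>2) powr \<alpha> * (- 2 * x)) (at x)"
      using x by (rule has_real_derivative_one_minus_square_powr)
    have m: "((\<lambda>x. x ^ (2 * q + 3)) has_real_derivative of_nat (2 * q + 3) * x ^ (2 * q + 2)) (at x)"
      by (rule derivative_eq_intros refl)+ simp
    have pw: "(1 - x\<^sup>2) powr (\<alpha> + 1) = (1 - x\<^sup>2) powr \<alpha> * (1 - x\<^sup>2)"
      using x by (simp add: powr_add)
    have xp: "x ^ (2 * q + 3) = x ^ (2 * q + 2) * x"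
      by (simp add: power_add power3_eq_cube power2_eq_square)
    have alg: "(N * X * (W * (1 - x\<^sup>2)) + (\<alpha> + 1) * W * (- 2 * x) * (X * x)) * P +
          P' * (2 * x) * (X * x * (W * (1 - x\<^sup>2))) =
        X * W * ((N + x\<^sup>2 * (- (N + 2 * (\<alpha> + 1)) + x\<^sup>2 * 0)) * P +
          (0 + x\<^sup>2 * (2 + x\<^sup>2 * (- 2 + x\<^sup>2 * 0))) * P')" for N X W P P' :: real
      by (simp add: algebra_simps power2_eq_square)
    show "(F has_vector_derivative x ^ (2 * q + 2) * (1 - x\<^sup>2) powr \<alpha> * poly f (x\<^sup>2)) (at x)"
      unfolding F_def has_real_derivative_iff_has_vector_derivative[symmetric]
      by (rule DERIV_cong[OF DERIV_mult[OF DERIV_mult[OF m w] p]])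
         (simp only: f_def pw xp poly_add poly_mult poly_pCons poly_0 alg)
  qed simp
  then have "integral {-1..1} (\<lambda>x. x ^ (2 * q + 2) * (1 - x\<^sup>2) powr \<alpha> * poly f (x\<^sup>2)) = 0"
    by (simp add: integral_unique F_def)
  then show ?thesis
    using set_borel_integral_eq_integral(2)[OF jacobi_integrable[OF \<alpha>, of q f]]
    by (simp add: jacobi_functional_def f_def)
qed

lemma poly_functional_weight:
  assumes "\<alpha> > -1"
  shows "poly_functional (weight_functional \<alpha> q)"
proof
  fix p p' :: "real poly" and c :: real
  show "weight_functional \<alpha> q (p + p') = weight_functional \<alpha> q p + weight_functional \<alpha> q p'"
    using set_integral_add(2)[OF weight_poly_integrable weight_poly_integrable, OF assms assms, of q p q p']
    by (simp add: weight_functional_def distrib_left)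
  show "weight_functional \<alpha> q (smult c p) = c * weight_functional \<alpha> q p"
    by (simp add: weight_functional_def mult.left_commute set_integral_mult_right)
qed

lemma positive_functional_jacobi:
  assumes "\<alpha> > -1"
  shows "positive_functional (jacobi_functional \<alpha> q)"
proof
  fix p p' :: "real poly" and c :: real
  show "jacobi_functional \<alpha> q (p + p') = jacobi_functional \<alpha> q p + jacobi_functional \<alpha> q p'"
    using set_integral_add(2)[OF jacobi_integrable jacobi_integrable, OF assms assms, of q p q p']
    by (simp add: jacobi_functional_def distrib_left)
  show "jacobi_functional \<alpha> q (smult c p) = c * jacobi_functional \<alpha> q p"
    by (simp add: jacobi_functional_def mult.left_commute set_integral_mult_right)
  assume "p \<noteq> 0" "\<And>x. x \<in> {0<..<1} \<Longrightarrow> 0 \<le> poly p x"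
  then show "0 < jacobi_functional \<alpha> q p"
    by (rule jacobi_functional_pos[OF assms])
qed

text \<open>
Multiplication by \<open>1 - t\<close> and by \<open>t\<close> raises the two exponents of the Jacobi weight, which is how
functionals with different parameters are compared.
\<close>

lemma jacobi_functional_one_minus:
  "jacobi_functional \<alpha> q ([:1, -1:] * p) = jacobi_functional (\<alpha> + 1) q p"
proof -
  have pw: "(1 - x\<^sup>2) powr (\<alpha> + 1) = (1 - x\<^sup>2) powr \<alpha> * (1 - x\<^sup>2)" if "x \<in> {-1..1}" for x :: real
    \<comment> \<open>At the endpoints both sides vanish because \<open>0 powr a = 0\<close> for every exponent.\<close>
  proof (cases "1 - x\<^sup>2 = 0")
    case False
    moreover have "x\<^sup>2 \<le> 1" using that by (auto simp: abs_square_le_1)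
    ultimately show ?thesis by (simp add: powr_add)
  qed simp
  show ?thesis
    unfolding jacobi_functional_def
    by (rule set_lebesgue_integral_cong) (auto simp: pw left_diff_distrib right_diff_distrib mult_ac)
qed

lemma jacobi_functional_times_X:
  "jacobi_functional \<alpha> q ([:0, 1:] * p) = jacobi_functional \<alpha> (q + 1) p"
  unfolding jacobi_functional_def
  by (rule set_lebesgue_integral_cong) (auto simp: algebra_simps power2_eq_square)

section \<open>The orthogonal polynomials of the sign-changing weight\<close>

abbreviation even_poly :: "real poly \<Rightarrow> real poly" where
  "even_poly p \<equiv> pcompose p (monom 1 2)"

lemma poly_even_poly: "poly (even_poly p) x = poly p (x\<^sup>2)"
  by (simp add: poly_pcompose poly_monom)

text \<open>
The part of the integrand that comes from \<open>x^(2q+1)\<close> is odd and integrates to zero. For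
\<open>x p(x^2)\<close> in place of \<open>p(x^2)\<close>, treated next, the two parts exchange their roles and the sign
changes.
\<close>

lemma weight_functional_even:
  assumes "\<alpha> > -1"
  shows "weight_functional \<alpha> q (even_poly p) = - jacobi_functional \<alpha> q p"
proof -
  define f where "f = (\<lambda>x::real. x ^ (2 * q + 1) * (1 - x\<^sup>2) powr \<alpha> * poly p (x\<^sup>2))"
  have "continuous_on UNIV (\<lambda>x. x ^ (2 * q) * poly p (x\<^sup>2))"
    by (intro continuous_intros)
  from integrable_x_times_powr_times[OF assms this]
  have "set_integrable lborel {-1..1} f"
    by (rule set_integrable_cong[THEN iffD1, rotated -1]) (auto simp: f_def mult_ac)
  moreover have "(LBINT x:{-1..1}. f x) = 0"
    by (rule odd_set_integral_eq_0) (simp add: f_def)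
  moreover have "weight_functional \<alpha> q (even_poly p) = (LBINT x:{-1..1}. f x -
      x ^ (2 * q + 2) * (1 - x\<^sup>2) powr \<alpha> * poly p (x\<^sup>2))"
    unfolding weight_functional_def poly_even_poly
    by (rule set_lebesgue_integral_cong) (auto simp: weight_def f_def algebra_simps)
  ultimately show ?thesis
    using jacobi_integrable[OF assms, of q p] by (simp add: jacobi_functional_def)
qed

lemma weight_functional_odd:
  assumes "\<alpha> > -1"
  shows "weight_functional \<alpha> q (monom 1 1 * even_poly p) = jacobi_functional \<alpha> q p"
proof -
  define f where "f = (\<lambda>x::real. x ^ (2 * q + 3) * (1 - x\<^sup>2) powr \<alpha> * poly p (x\<^sup>2))"
  have "continuous_on UNIV (\<lambda>x. x ^ (2 * q + 2) * poly p (x\<^sup>2))"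
    by (intro continuous_intros)
  from integrable_x_times_powr_times[OF assms this]
  have "set_integrable lborel {-1..1} f"
    by (rule set_integrable_cong[THEN iffD1, rotated -1])
       (auto simp: f_def eval_nat_numeral mult_ac)
  moreover have "(LBINT x:{-1..1}. f x) = 0"
    by (rule odd_set_integral_eq_0) (simp add: f_def)
  moreover have "weight_functional \<alpha> q (monom 1 1 * even_poly p) = (LBINT x:{-1..1}.
      x ^ (2 * q + 2) * (1 - x\<^sup>2) powr \<alpha> * poly p (x\<^sup>2) - f x)"
    unfolding weight_functional_def poly_even_poly poly_mult
    by (rule set_lebesgue_integral_cong)
       (auto simp: weight_def f_def poly_monom eval_nat_numeral algebra_simps)
  ultimately show ?thesis
    using jacobi_integrable[OF assms, of q p] by (simp add: jacobi_functional_def)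
qed

lemma monom_even_times_even_poly:
  "monom 1 (2 * l) * even_poly p = even_poly (monom 1 l * p)"
  by (rule poly_eq_poly_eq_iff[THEN iffD1])
     (auto simp: fun_eq_iff poly_pcompose poly_monom power_mult)

lemma monom_odd_times_even_poly:
  "monom 1 (2 * l + 1) * even_poly p = monom 1 1 * even_poly (monom 1 l * p)"
  unfolding monom_even_times_even_poly[symmetric] mult.assoc[symmetric] mult_monom by simp

lemma monic_even_poly:
  assumes "degree R = m" "lead_coeff R = (1::real)"
  shows "degree (even_poly R) = 2 * m" "lead_coeff (even_poly R) = 1"
  using assms lead_coeff_comp[of "monom (1::real) 2" R]
  by (simp_all add: degree_pcompose degree_monom_eq)

lemma monic_ops_weight_iff:
  assumes "\<alpha> > -1"
  shows "monic_ops (weight \<alpha> q) P \<longleftrightarrow>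
    poly_functional.monic_orthogonal_seq (weight_functional \<alpha> q) P"
  unfolding monic_ops_def weight_functional_def
    poly_functional.monic_orthogonal_seq_def[OF poly_functional_weight[OF assms, of q]]
  by (simp add: poly_monom mult.assoc)

text \<open>
The sequence behind the definite description is exhibited, and uniqueness then identifies it. In odd
degree the factor \<open>x + 1\<close> combines with \<open>1 - x\<close> in the weight to \<open>1 - x^2\<close>, which raises \<open>\<alpha>\<close> by one
and leaves an odd weight; orthogonality to even powers is then automatic.
\<close>

lemma ortho_poly_even_degree:
  assumes \<alpha>: "\<alpha> > -1"
    and R: "positive_functional.orthogonal_poly (jacobi_functional \<alpha> q) m R"
  shows "ortho_poly \<alpha> q (2 * m) = even_poly R"
proof -
  interpret M: poly_functional "weight_functional \<alpha> q"
    using \<alpha> by (rule poly_functional_weight)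
  interpret J: positive_functional "jacobi_functional \<alpha> q"
    using \<alpha> by (rule positive_functional_jacobi)
  interpret J1: positive_functional "jacobi_functional (\<alpha> + 1) q"
    using \<alpha> by (intro positive_functional_jacobi) simp
  obtain U where U: "\<And>m. J.orthogonal_poly m (U m)"
    using J.orthogonal_poly_exists by metis
  obtain V where V: "\<And>m. J1.orthogonal_poly m (V m)"
    using J1.orthogonal_poly_exists by metis
  define P where "P = (\<lambda>n. if even n then even_poly (U (n div 2))
                          else [:1, 1:] * even_poly (V (n div 2)))"
  have P_even: "weight_functional \<alpha> q (monom 1 (2 * l) * even_poly p) =
      - jacobi_functional \<alpha> q (monom 1 l * p)" for l p
    unfolding monom_even_times_even_poly using \<alpha> by (rule weight_functional_even)
  have P_odd: "weight_functional \<alpha> q (monom 1 (2 * l + 1) * even_poly p) =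
      jacobi_functional \<alpha> q (monom 1 l * p)" for l p
    unfolding monom_odd_times_even_poly using \<alpha> by (rule weight_functional_odd)
  have X1: "monom 1 k * ([:1, 1:] * p) = monom 1 k * p + monom 1 (k + 1) * (p :: real poly)" for k p
    by (simp add: monom_Suc algebra_simps)
  have Q_even: "weight_functional \<alpha> q (monom 1 (2 * l) * ([:1, 1:] * even_poly p)) = 0" for l p
    unfolding X1 M.add P_even P_odd by simp
  have Q_odd: "weight_functional \<alpha> q (monom 1 (2 * l + 1) * ([:1, 1:] * even_poly p)) =
      jacobi_functional (\<alpha> + 1) q (monom 1 l * p)" for l p
  proof -
    have *: "2 * l + 1 + 1 = 2 * (l + 1)" by simp
    have "jacobi_functional (\<alpha> + 1) q (monom 1 l * p) =
        jacobi_functional \<alpha> q ([:1, -1:] * (monom 1 l * p))"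
      by (rule jacobi_functional_one_minus[symmetric])
    also have "[:1, -1:] * (monom 1 l * p) = monom 1 l * p - monom 1 (l + 1) * p"
      by (simp add: monom_Suc algebra_simps)
    finally show ?thesis
      unfolding X1 M.add * P_even P_odd J.diff by simp
  qed
  have "M.monic_orthogonal_seq P"
    unfolding M.monic_orthogonal_seq_def
  proof (intro allI)
    fix n
    show "degree (P n) = n \<and> lead_coeff (P n) = 1 \<and>
      (\<forall>k<n. weight_functional \<alpha> q (monom 1 k * P n) = 0) \<and>
      weight_functional \<alpha> q (monom 1 n * P n) \<noteq> 0"
    proof (cases "even n")
      case True
      then obtain m where n: "n = 2 * m" by blast
      have Um: "degree (U m) = m" "lead_coeff (U m) = 1"
        "\<And>l. l < m \<Longrightarrow> jacobi_functional \<alpha> q (monom 1 l * U m) = 0"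
        using U[of m] unfolding J.orthogonal_poly_def by (auto simp: degree_monom_eq)
      have Pn: "P n = even_poly (U m)" by (simp add: P_def n)
      have "weight_functional \<alpha> q (monom 1 k * P n) = 0" if "k < n" for k
      proof (cases "even k")
        case True
        then obtain l where l: "k = 2 * l" by blast
        with that n Um(3)[of l] show ?thesis unfolding Pn l P_even by simp
      next
        case False
        then obtain l where l: "k = 2 * l + 1" by (rule oddE)
        with that n Um(3)[of l] show ?thesis unfolding Pn l P_odd by simp
      qed
      moreover have "weight_functional \<alpha> q (monom 1 n * P n) \<noteq> 0"
        using J.orthogonal_poly_norm_pos[OF U, of m] unfolding Pn unfolding n P_even by simp
      ultimately show ?thesis
        using monic_even_poly[OF Um(1,2)] Pn n by metis
    next
      case False
      then obtain m where n: "n = 2 * m + 1" by (rule oddE)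
      have Vm: "degree (V m) = m" "lead_coeff (V m) = 1"
        "\<And>l. l < m \<Longrightarrow> jacobi_functional (\<alpha> + 1) q (monom 1 l * V m) = 0"
        using V[of m] unfolding J1.orthogonal_poly_def by (auto simp: degree_monom_eq)
      have Pn: "P n = [:1, 1:] * even_poly (V m)" by (simp add: P_def n)
      have "weight_functional \<alpha> q (monom 1 k * P n) = 0" if "k < n" for k
      proof (cases "even k")
        case True
        then obtain l where l: "k = 2 * l" by blast
        show ?thesis unfolding Pn l by (rule Q_even)
      next
        case False
        then obtain l where l: "k = 2 * l + 1" by (rule oddE)
        with that n Vm(3)[of l] show ?thesis unfolding Pn l Q_odd by simp
      qed
      moreover have "weight_functional \<alpha> q (monom 1 n * P n) \<noteq> 0"
        using J1.orthogonal_poly_norm_pos[OF V, of m] unfolding Pn unfolding n Q_odd by simp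
      moreover have "lead_coeff (P n) = 1"
        unfolding Pn lead_coeff_mult monic_even_poly(2)[OF Vm(1,2)] by simp
      moreover have "degree (P n) = n"
      proof -
        have "even_poly (V m) \<noteq> 0" using monic_even_poly(2)[OF Vm(1,2)] by auto
        then show ?thesis
          unfolding Pn by (subst degree_mult_eq) (auto simp: monic_even_poly(1)[OF Vm(1,2)] n)
      qed
      ultimately show ?thesis by blast
    qed
  qed
  then have "ortho_poly \<alpha> q = P"
    unfolding ortho_poly_def monic_ops_weight_iff[OF \<alpha>]
    by (intro the_equality) (blast intro: M.monic_orthogonal_seq_unique)+
  moreover have "U m = R" using U R by (rule J.orthogonal_poly_unique)
  ultimately show ?thesis by (simp add: P_def)
qed

section \<open>Differentiation and the largest zero\<close>

text \<open>
Raising both parameters multiplies the weight by \<open>t (1-t)\<close>, so the functional with raised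
parameters at \<open>p R'\<close> is that of \<open>t (1-t) p R'\<close>. Integration by parts moves the derivative off \<open>R\<close>
and leaves \<open>R\<close> multiplied by \<open>\<tau> p + \<sigma> p'\<close>, whose degree exceeds that of \<open>p\<close> by at most one and
hence is still below the degree of \<open>R\<close>.
\<close>

lemma pderiv_orthogonal:
  assumes \<alpha>: "\<alpha> > -1"
    and R: "positive_functional.orthogonal_poly (jacobi_functional \<alpha> q) (Suc m) R"
  shows "positive_functional.orthogonal_poly (jacobi_functional (\<alpha> + 1) (q + 1)) m
    (smult (1 / real (Suc m)) (pderiv R))"
proof -
  interpret J: positive_functional "jacobi_functional \<alpha> q"
    using \<alpha> by (rule positive_functional_jacobi)
  interpret J': positive_functional "jacobi_functional (\<alpha> + 1) (q + 1)"
    using \<alpha> by (intro positive_functional_jacobi) simp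
  have R': "degree R = Suc m" "lead_coeff R = 1"
    "\<And>p. degree p < Suc m \<Longrightarrow> jacobi_functional \<alpha> q (p * R) = 0"
    using R by (auto simp: J.orthogonal_poly_def)
  have "jacobi_functional (\<alpha> + 1) (q + 1) (p * pderiv R) = 0" if "degree p < m" for p
  proof -
    define \<tau> where "\<tau> = [:of_nat (2 * q + 3), - (of_nat (2 * q + 3) + 2 * (\<alpha> + 1)):]"
    define \<sigma> where "\<sigma> = [:0, 2, -2 :: real:]"
    have "degree (\<tau> * p) < Suc m"
      using degree_mult_le[of \<tau> p] that by (auto simp: \<tau>_def split: if_splits)
    moreover have "degree (\<sigma> * pderiv p) < Suc m"
    proof (cases "degree p = 0")
      case True
      then have "pderiv p = 0" by (simp add: pderiv_eq_0_iff)
      then show ?thesis by simp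
    next
      case False
      moreover have "degree \<sigma> \<le> 2" by (simp add: \<sigma>_def)
      ultimately show ?thesis
        using degree_mult_le[of \<sigma> "pderiv p"] that degree_pderiv[of p] by linarith
    qed
    ultimately have 1: "jacobi_functional \<alpha> q ((\<tau> * p + \<sigma> * pderiv p) * R) = 0"
      by (intro R'(3) degree_add_less)
    have eq: "\<tau> * (p * R) + \<sigma> * pderiv (p * R) =
        (\<tau> * p + \<sigma> * pderiv p) * R + \<sigma> * (p * pderiv R)"
      by (simp add: pderiv_mult algebra_simps)
    have "jacobi_functional \<alpha> q (\<tau> * (p * R) + \<sigma> * pderiv (p * R)) = 0"
      unfolding \<tau>_def \<sigma>_def using \<alpha> by (rule jacobi_pearson)
    then have "jacobi_functional \<alpha> q (\<sigma> * (p * pderiv R)) = 0"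
      unfolding eq J.add[of "(\<tau> * p + \<sigma> * pderiv p) * R"] 1 by simp
    moreover have "\<sigma> = smult 2 ([:1, -1:] * [:0, 1:])" by (simp add: \<sigma>_def)
    ultimately have "jacobi_functional \<alpha> q ([:1, -1:] * ([:0, 1:] * (p * pderiv R))) = 0"
      by (simp only: mult_smult_left J.smult mult.assoc)
    then show ?thesis
      by (simp only: jacobi_functional_one_minus jacobi_functional_times_X)
  qed
  then have "jacobi_functional (\<alpha> + 1) (q + 1) (p * smult (1 / real (Suc m)) (pderiv R)) = 0"
    if "degree p < m" for p
    using that by (simp only: mult_smult_right J'.smult mult_zero_right)
  moreover have "degree (pderiv R) = m" using R'(1) by (simp add: degree_pderiv)
  moreover have "coeff (pderiv R) m = real (Suc m)" using R'(1,2) by (simp add: coeff_pderiv)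
  ultimately show ?thesis
    unfolding J'.orthogonal_poly_def by (simp del: mult_smult_right)
qed

lemma largest_zero_eq_sqrt_Max:
  assumes \<alpha>: "\<alpha> > -1"
    and R: "positive_functional.orthogonal_poly (jacobi_functional \<alpha> q) m R"
    and A: "R = (\<Prod>r\<in>A. [:-r, 1:])" "finite A" "A \<noteq> {}" "A \<subseteq> {0<..<1}"
  shows "largest_zero \<alpha> q (2 * m) = sqrt (Max A)"
proof -
  have zeros: "{x. poly (ortho_poly \<alpha> q (2 * m)) x = 0} = {x. x\<^sup>2 \<in> A}"
    using A(2) unfolding ortho_poly_even_degree[OF \<alpha> R] poly_even_poly A(1)
    by (auto simp: poly_prod)
  have "x \<in> sqrt ` A \<union> uminus ` sqrt ` A" if "x\<^sup>2 \<in> A" for x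
  proof (cases "x \<ge> 0")
    case True
    then have "x = sqrt (x\<^sup>2)" by simp
    then show ?thesis using that by blast
  next
    case False
    then have "x = - sqrt (x\<^sup>2)" by simp
    then show ?thesis using that by blast
  qed
  then have "{x. x\<^sup>2 \<in> A} \<subseteq> sqrt ` A \<union> uminus ` sqrt ` A" by blast
  then have "finite {x. x\<^sup>2 \<in> A}"
    by (rule finite_subset) (use A(2) in simp)
  moreover have "x \<le> sqrt (Max A)" if "x\<^sup>2 \<in> A" for x
    using A(2) that by (intro real_le_rsqrt) simp
  moreover have "(sqrt (Max A))\<^sup>2 \<in> A"
  proof -
    have "Max A \<in> A" "Max A \<ge> 0"
      using Max_in[OF A(2,3)] A(4) by (auto simp: less_imp_le)
    then show ?thesis by simp
  qed
  ultimately show ?thesis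
    unfolding largest_zero_def zeros by (intro Max_eqI) auto
qed

text \<open>
The assumption \<open>m \<ge> 1\<close> guarantees that the derivative has a root at all.
\<close>

lemma largest_zero_step:
  assumes \<alpha>: "\<alpha> > -1" and "m \<ge> 1"
  shows "largest_zero (\<alpha> + 1) (q + 1) (2 * m) < largest_zero \<alpha> q (2 * Suc m)"
proof -
  interpret J: positive_functional "jacobi_functional \<alpha> q"
    using \<alpha> by (rule positive_functional_jacobi)
  have \<alpha>': "\<alpha> + 1 > -1" using \<alpha> by simp
  interpret J': positive_functional "jacobi_functional (\<alpha> + 1) (q + 1)"
    using \<alpha>' by (rule positive_functional_jacobi)
  obtain R where R: "J.orthogonal_poly (Suc m) R" using J.orthogonal_poly_exists by blast
  define S where "S = smult (1 / real (Suc m)) (pderiv R)"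
  have S: "J'.orthogonal_poly m S" unfolding S_def using \<alpha> R by (rule pderiv_orthogonal)
  obtain A where A: "A \<subseteq> {0<..<1}" "finite A" "card A = Suc m" "R = (\<Prod>r\<in>A. [:-r, 1:])"
    using J.orthogonal_poly_splits[OF R] by blast
  obtain B where B: "B \<subseteq> {0<..<1}" "finite B" "card B = m" "S = (\<Prod>r\<in>B. [:-r, 1:])"
    using J'.orthogonal_poly_splits[OF S] by blast
  have ne: "A \<noteq> {}" "B \<noteq> {}" using A(3) B(3) \<open>m \<ge> 1\<close> by auto
  have "poly S (Max B) = 0"
    unfolding B(4) using B(2) ne(2) by (auto simp: poly_prod)
  then have "poly (pderiv R) (Max B) = 0" by (simp add: S_def)
  then have "Max B < Max A"
    using pderiv_pos_right_of_roots[OF A(2) ne(1), of "Max B"] unfolding A(4) by force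
  then show ?thesis
    using largest_zero_eq_sqrt_Max[OF \<alpha> R A(4,2) ne(1) A(1)]
      largest_zero_eq_sqrt_Max[OF \<alpha>' S B(4,2) ne(2) B(1)] by simp
qed

theorem proposition4p3:
  fixes \<alpha> :: real and q n i j :: nat
  assumes "\<alpha> > -1" and "n \<ge> 1" and "i < j" and "j \<le> n - 1"
  shows "largest_zero (\<alpha> + real j) (q + j) (2 * n - 2 * j)
       < largest_zero (\<alpha> + real i) (q + i) (2 * n - 2 * i)"
proof -
  define z where "z k = largest_zero (\<alpha> + real k) (q + k) (2 * n - 2 * k)" for k
  have step: "z (Suc k) < z k" if "Suc k \<le> n - 1" for k
  proof -
    \<comment> \<open>The natural-number subtractions are exact here because \<open>k < n\<close>.\<close>
    have degs: "2 * n - 2 * Suc k = 2 * (n - Suc k)" "2 * n - 2 * k = 2 * Suc (n - Suc k)"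
      using that by (simp_all add: Suc_diff_Suc flip: diff_mult_distrib2)
    have "largest_zero (\<alpha> + real k + 1) (q + k + 1) (2 * (n - Suc k)) <
        largest_zero (\<alpha> + real k) (q + k) (2 * Suc (n - Suc k))"
      using that assms(1) by (intro largest_zero_step) auto
    moreover have "\<alpha> + real (Suc k) = \<alpha> + real k + 1" "q + Suc k = q + k + 1"
      by simp_all
    ultimately show ?thesis unfolding z_def degs by metis
  qed
  have "i < j \<Longrightarrow> j \<le> n - 1 \<Longrightarrow> z j < z i"
  proof (induction j)
    case (Suc j)
    then show ?case using step[of j] by (cases "i = j") auto
  qed simp
  then show ?thesis using assms by (simp add: z_def)
qed

end
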